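(* There is a polynomial-time algorithm that, given a hedonic expertise game $\mathcal{G} = (N, S, e, \kappa)$, outputs a contractually individually stable partition of $\mathcal{G}$.
   Context: A hedonic expertise game (HEG) is $\mathcal{G} = (N, S, e, \kappa)$, where $N$ is a finite set of agents, $S$ is a finite set of skills, for each agent $i \in N$ there is a non-negative real-valued expertise function $e_i : S \to \mathbb{R}_{\ge 0}$, and $\kappa$ is a positive integer (upper bound on coalition sizes). An instance is given explicitly by the numbers $e_i(s)$ ($i \in N$, $s \in S$) and $\kappa$; arithmetic operations and comparisons on these numbers are elementary operations, and polynomial time means polynomial in $|N|$ and $|S|$. For a nonempty $C \subseteq N$ let $E_C(s) = \max_{i \in C} e_i(s)$ and define the joint utility $U(C) = \sum_{s \in S} E_C(s)$; by convention $U(\emptyset) = 0$. A coalition is a nonempty subset of $N$ of size at most $\kappa$. A solution is a partition $\pi$ of $N$ into coalitions; all partitions considered are of this kind. $\pi(i)$ denotes the coalition of $\pi$ containing $i$. A partition $\pi$ is contractually individually stable if for every agent $i \in N$ and every $C \in \pi$ with $C \neq \pi(i)$ and $|C| < \kappa$, at least one of the following holds: $U(\pi(i)) \ge U(C \cup \{i\})$; or $U(C) > U(C \cup \{i\})$; or $U(\pi(i)) > U(\pi(i) \setminus \{i\})$. That is, no agent can benefit from moving to another existing non-full coalition without making an agent of the joined or the abandoned coalition worse off. *)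

theory Defs
  imports Complex_Main "HOL-Library.Disjoint_Sets"
begin

subsection \<open>Hedonic expertise games\<close>

definition heg :: "'a set \<Rightarrow> 'b set \<Rightarrow> ('a \<Rightarrow> 'b \<Rightarrow> real) \<Rightarrow> nat \<Rightarrow> bool" where
  "heg N S e \<kappa> \<longleftrightarrow> finite N \<and> finite S \<and> (\<forall>i\<in>N. \<forall>s\<in>S. 0 \<le> e i s) \<and> 0 < \<kappa>"

definition expertise :: "('a \<Rightarrow> 'b \<Rightarrow> real) \<Rightarrow> 'a set \<Rightarrow> 'b \<Rightarrow> real" where
  "expertise e C s = Max ((\<lambda>i. e i s) ` C)"

definition utility :: "'b set \<Rightarrow> ('a \<Rightarrow> 'b \<Rightarrow> real) \<Rightarrow> 'a set \<Rightarrow> real" where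
  "utility S e C = (if C = {} then 0 else (\<Sum>s\<in>S. expertise e C s))"

definition solution :: "'a set \<Rightarrow> nat \<Rightarrow> 'a set set \<Rightarrow> bool" where
  "solution N \<kappa> \<pi> \<longleftrightarrow> partition_on N \<pi> \<and> (\<forall>C\<in>\<pi>. card C \<le> \<kappa>)"

definition coalition_of :: "'a set set \<Rightarrow> 'a \<Rightarrow> 'a set" where
  "coalition_of \<pi> i = (THE C. C \<in> \<pi> \<and> i \<in> C)"

definition contractually_individually_stable ::
  "'a set \<Rightarrow> 'b set \<Rightarrow> ('a \<Rightarrow> 'b \<Rightarrow> real) \<Rightarrow> nat \<Rightarrow> 'a set set \<Rightarrow> bool" where
  "contractually_individually_stable N S e \<kappa> \<pi> \<longleftrightarrow>
     solution N \<kappa> \<pi> \<and>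
     (\<forall>i\<in>N. \<forall>C\<in>\<pi>. C \<noteq> coalition_of \<pi> i \<and> card C < \<kappa> \<longrightarrow>
        utility S e (coalition_of \<pi> i) \<ge> utility S e (C \<union> {i}) \<or>
        utility S e C > utility S e (C \<union> {i}) \<or>
        utility S e (coalition_of \<pi> i) > utility S e (coalition_of \<pi> i - {i}))"


subsection \<open>A real RAM\<close>

text \<open>
  Programs are while programs over two separate memories, one holding natural numbers
  (indices, labels, counters) and one holding real numbers. Each memory consists of arrays;
  a program mentions finitely many array names, and indices are computed at run time.

  Every elementary operation and every memory access costs one unit, whatever the size of the
  numbers. Natural numbers can only be added, subtracted and compared (no multiplication or
  division), so that unit cost gives them no unreasonable power. Real numbers admit the field
  operations and comparison, but they cannot be rounded, turned into natural numbers or used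
  as indices, and the only real constants are integers.
\<close>

datatype nexp =
    NConst nat
  | NGet nat nexp \<comment> \<open>array name, index\<close>
  | NAdd nexp nexp
  | NSub nexp nexp

datatype rexp =
    RConst int
  | RGet nat nexp
  | RAdd rexp rexp
  | RSub rexp rexp
  | RMul rexp rexp
  | RDiv rexp rexp

datatype bexp =
    NLe nexp nexp
  | RLe rexp rexp
  | BNot bexp
  | BAnd bexp bexp

datatype com =
    Skip
  | NSet nat nexp nexp \<comment> \<open>array name, index, new value\<close>
  | RSet nat nexp rexp
  | Seq com com
  | Cond bexp com com
  | Loop bexp com

record state =
  nmem :: "nat \<Rightarrow> nat \<Rightarrow> nat"
  rmem :: "nat \<Rightarrow> nat \<Rightarrow> real"

text \<open>Subtraction of natural numbers is truncated, and division of reals by zero yields zero.\<close>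

primrec nval :: "nexp \<Rightarrow> state \<Rightarrow> nat" where
  "nval (NConst k) \<sigma> = k"
| "nval (NGet a i) \<sigma> = nmem \<sigma> a (nval i \<sigma>)"
| "nval (NAdd x y) \<sigma> = nval x \<sigma> + nval y \<sigma>"
| "nval (NSub x y) \<sigma> = nval x \<sigma> - nval y \<sigma>"

primrec rval :: "rexp \<Rightarrow> state \<Rightarrow> real" where
  "rval (RConst k) \<sigma> = of_int k"
| "rval (RGet a i) \<sigma> = rmem \<sigma> a (nval i \<sigma>)"
| "rval (RAdd x y) \<sigma> = rval x \<sigma> + rval y \<sigma>"
| "rval (RSub x y) \<sigma> = rval x \<sigma> - rval y \<sigma>"
| "rval (RMul x y) \<sigma> = rval x \<sigma> * rval y \<sigma>"
| "rval (RDiv x y) \<sigma> = rval x \<sigma> / rval y \<sigma>"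

primrec bval :: "bexp \<Rightarrow> state \<Rightarrow> bool" where
  "bval (NLe x y) \<sigma> \<longleftrightarrow> nval x \<sigma> \<le> nval y \<sigma>"
| "bval (RLe x y) \<sigma> \<longleftrightarrow> rval x \<sigma> \<le> rval y \<sigma>"
| "bval (BNot b) \<sigma> \<longleftrightarrow> \<not> bval b \<sigma>"
| "bval (BAnd b c) \<sigma> \<longleftrightarrow> bval b \<sigma> \<and> bval c \<sigma>"

primrec ncost :: "nexp \<Rightarrow> nat" where
  "ncost (NConst k) = 1"
| "ncost (NGet a i) = 1 + ncost i"
| "ncost (NAdd x y) = 1 + ncost x + ncost y"
| "ncost (NSub x y) = 1 + ncost x + ncost y"

primrec rcost :: "rexp \<Rightarrow> nat" where
  "rcost (RConst k) = 1"
| "rcost (RGet a i) = 1 + ncost i"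
| "rcost (RAdd x y) = 1 + rcost x + rcost y"
| "rcost (RSub x y) = 1 + rcost x + rcost y"
| "rcost (RMul x y) = 1 + rcost x + rcost y"
| "rcost (RDiv x y) = 1 + rcost x + rcost y"

primrec bcost :: "bexp \<Rightarrow> nat" where
  "bcost (NLe x y) = 1 + ncost x + ncost y"
| "bcost (RLe x y) = 1 + rcost x + rcost y"
| "bcost (BNot b) = 1 + bcost b"
| "bcost (BAnd b c) = 1 + bcost b + bcost c"

definition nupdate :: "nat \<Rightarrow> nat \<Rightarrow> nat \<Rightarrow> state \<Rightarrow> state" where
  "nupdate a k v \<sigma> = \<sigma>\<lparr>nmem := (nmem \<sigma>)(a := (nmem \<sigma> a)(k := v))\<rparr>"

definition rupdate :: "nat \<Rightarrow> nat \<Rightarrow> real \<Rightarrow> state \<Rightarrow> state" where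
  "rupdate a k v \<sigma> = \<sigma>\<lparr>rmem := (rmem \<sigma>)(a := (rmem \<sigma> a)(k := v))\<rparr>"

text \<open>\<open>exec P \<sigma> t \<tau>\<close>: program \<open>P\<close>, started in \<open>\<sigma>\<close>, halts in \<open>\<tau>\<close> after \<open>t\<close> steps.\<close>

inductive exec :: "com \<Rightarrow> state \<Rightarrow> nat \<Rightarrow> state \<Rightarrow> bool" where
  Skip: "exec Skip \<sigma> 1 \<sigma>"
| NSet: "exec (NSet a i x) \<sigma> (1 + ncost i + ncost x) (nupdate a (nval i \<sigma>) (nval x \<sigma>) \<sigma>)"
| RSet: "exec (RSet a i x) \<sigma> (1 + ncost i + rcost x) (rupdate a (nval i \<sigma>) (rval x \<sigma>) \<sigma>)"
| Seq: "exec P \<sigma> t \<rho> \<Longrightarrow> exec Q \<rho> u \<tau> \<Longrightarrow> exec (Seq P Q) \<sigma> (t + u) \<tau>"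
| CondTrue: "bval b \<sigma> \<Longrightarrow> exec P \<sigma> t \<tau> \<Longrightarrow> exec (Cond b P Q) \<sigma> (1 + bcost b + t) \<tau>"
| CondFalse: "\<not> bval b \<sigma> \<Longrightarrow> exec Q \<sigma> t \<tau> \<Longrightarrow> exec (Cond b P Q) \<sigma> (1 + bcost b + t) \<tau>"
| LoopFalse: "\<not> bval b \<sigma> \<Longrightarrow> exec (Loop b P) \<sigma> (1 + bcost b) \<sigma>"
| LoopTrue: "bval b \<sigma> \<Longrightarrow> exec P \<sigma> t \<rho> \<Longrightarrow> exec (Loop b P) \<rho> u \<tau> \<Longrightarrow>
    exec (Loop b P) \<sigma> (1 + bcost b + t + u) \<tau>"

inductive_cases SkipE: "exec Skip \<sigma> t \<tau>"
inductive_cases NSetE: "exec (NSet a i x) \<sigma> t \<tau>"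
inductive_cases RSetE: "exec (RSet a i x) \<sigma> t \<tau>"
inductive_cases SeqE: "exec (Seq P Q) \<sigma> t \<tau>"
inductive_cases CondE: "exec (Cond b P Q) \<sigma> t \<tau>"
inductive_cases LoopE: "exec (Loop b P) \<sigma> t \<tau>"

lemma exec_deterministic:
  "exec P \<sigma> t \<tau> \<Longrightarrow> exec P \<sigma> t' \<tau>' \<Longrightarrow> t' = t \<and> \<tau>' = \<tau>"
proof (induction arbitrary: t' \<tau>' rule: exec.induct)
  case (Skip \<sigma>)
  from Skip.prems show ?case by (rule SkipE) simp
next
  case (NSet a i x \<sigma>)
  from NSet.prems show ?case by (rule NSetE) simp
next
  case (RSet a i x \<sigma>)
  from RSet.prems show ?case by (rule RSetE) simp
next
  case (Seq P \<sigma> t \<rho> Q u \<tau>)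
  from Seq.prems show ?case
  proof (rule SeqE)
    fix t1 \<rho>1 u1
    assume t': "t' = t1 + u1" and "exec P \<sigma> t1 \<rho>1" and rest: "exec Q \<rho>1 u1 \<tau>'"
    then have "t1 = t \<and> \<rho>1 = \<rho>" by (intro Seq.IH(1))
    moreover from this rest have "u1 = u \<and> \<tau>' = \<tau>" by (intro Seq.IH(2)) simp
    ultimately show ?thesis using t' by simp
  qed
next
  case (CondTrue b \<sigma> P t \<tau> Q)
  from CondTrue.prems show ?case 
    by (rule CondE) (use CondTrue.hyps in \<open>auto dest: CondTrue.IH\<close>)
next
  case (CondFalse b \<sigma> Q t \<tau> P)
  from CondFalse.prems show ?case 
    by (rule CondE) (use CondFalse.hyps in \<open>auto dest: CondFalse.IH\<close>)
next
  case (LoopFalse b \<sigma> P)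
  from LoopFalse.prems show ?case by (rule LoopE) (use LoopFalse.hyps in auto)
next
  case (LoopTrue b \<sigma> P t \<rho> u \<tau>)
  from LoopTrue.prems show ?case
  proof (rule LoopE)
    fix t1 \<rho>1 u1
    assume t': "t' = Suc (bcost b + t1 + u1)"
      and "exec P \<sigma> t1 \<rho>1" and loop: "exec (Loop b P) \<rho>1 u1 \<tau>'"
    then have "t1 = t \<and> \<rho>1 = \<rho>" by (intro LoopTrue.IH(1))
    moreover from this loop have "u1 = u \<and> \<tau>' = \<tau>" by (intro LoopTrue.IH(2)) simp
    ultimately show ?thesis using t' by simp
  qed (use LoopTrue.hyps in simp)
qed


subsection \<open>Input and output\<close>

text \<open>
  The agents and the skills are listed as \<open>xs\<close> and \<open>ss\<close>. Cells 0, 1, 2 of natural array 0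
  contain the number of agents, the number of skills and the size bound; real array 0 contains
  the expertise matrix row by row. All other cells are zero.
\<close>

definition heg_input :: "'a list \<Rightarrow> 'b list \<Rightarrow> ('a \<Rightarrow> 'b \<Rightarrow> real) \<Rightarrow> nat \<Rightarrow> state" where
  "heg_input xs ss e \<kappa> =
     \<lparr>nmem = (\<lambda>_ _. 0)(0 := (\<lambda>_. 0)(0 := length xs, 1 := length ss, 2 := \<kappa>)),
      rmem = (\<lambda>_ _. 0)(0 := (\<lambda>k. if k < length xs * length ss
                                then e (xs ! (k div length ss)) (ss ! (k mod length ss)) else 0))\<rparr>"

text \<open>
  Natural array 1 of the final state contains a label for each agent; agents with the same label
  form a coalition.
\<close>

definition output_partition :: "'a list \<Rightarrow> state \<Rightarrow> 'a set set" where
  "output_partition xs \<sigma> =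
     {{xs ! j | j. j < length xs \<and> nmem \<sigma> 1 j = nmem \<sigma> 1 i} | i. i < length xs}"

text \<open>
  The program and the constants of the time bound are chosen before the game, and the same
  program has to work for every listing of the agents and skills.
\<close>

definition poly_time_computes_heg ::
  "('a set \<Rightarrow> 'b set \<Rightarrow> ('a \<Rightarrow> 'b \<Rightarrow> real) \<Rightarrow> nat \<Rightarrow> 'a set set \<Rightarrow> bool) \<Rightarrow> com \<Rightarrow> bool" where
  "poly_time_computes_heg R P \<longleftrightarrow>
     (\<exists>c d :: nat. \<forall>N S e \<kappa> xs ss.
        heg N S e \<kappa> \<and> distinct xs \<and> set xs = N \<and> distinct ss \<and> set ss = S \<longrightarrow>
        (\<exists>t \<tau>. exec P (heg_input xs ss e \<kappa>) t \<tau> \<and>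
               t \<le> c * (1 + card N + card S) ^ d \<and>
               R N S e \<kappa> (output_partition xs \<tau>)))"

end

theory Submission
  imports Defs
begin

text \<open>
  Since \<open>U({}) = 0\<close>, an agent whose own expertise is not identically zero would hurt the coalition
  it abandons if all the other members have expertise zero. So let every such agent lead a
  coalition of its own, and let the agents of expertise zero, one after another, join a leader of
  maximal total expertise among those whose coalition is not full yet, staying alone if there is
  none. Joining agents do not change utilities, and full coalitions remain full, so an agent of
  expertise zero never finds a better coalition with a free place later on.
\<close>

subsection \<open>The partition induced by a greedy labelling\<close>

text \<open>A member that dominates in every skill attains all the maxima at once. Every nonempty
  coalition below is evaluated through such a member.\<close>

lemma utility_eq_leader:
  assumes "finite C" "x \<in> C" "\<And>y s. y \<in> C \<Longrightarrow> s \<in> S \<Longrightarrow> e y s \<le> e x s"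
  shows "utility S e C = (\<Sum>s\<in>S. e x s)"
proof -
  have "expertise e C s = e x s" if "s \<in> S" for s
    unfolding expertise_def using assms that by (intro Max_eqI) auto
  with \<open>x \<in> C\<close> show ?thesis by (auto simp: utility_def)
qed

text \<open>A leader \<open>j\<close>, having \<open>0 < u j\<close>, is not counted, so one place
  has to be added for it. An agent of total 0 left alone counts itself, so that one counter
  increment treats both outcomes of the search.\<close>

definition joined :: "(nat \<Rightarrow> real) \<Rightarrow> nat \<Rightarrow> (nat \<Rightarrow> nat) \<Rightarrow> nat \<Rightarrow> nat set" where
  "joined u i lab j = {a. a < i \<and> u a \<le> 0 \<and> lab a = j}"

text \<open>An invariant for the first \<open>i\<close> agents; a leader may be joined before its
  own turn. The last clause is the greedy choice in retrospect: every leader better than the one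
  chosen is full, where \<open>Suc\<close> accounts for the leader's own place.\<close>

definition greedy :: "(nat \<Rightarrow> real) \<Rightarrow> nat \<Rightarrow> nat \<Rightarrow> nat \<Rightarrow> (nat \<Rightarrow> nat) \<Rightarrow> bool" where
  "greedy u n \<kappa> i lab \<longleftrightarrow>
     (\<forall>a<i. lab a = a \<or> u a \<le> 0 \<and> lab a < n \<and> 0 < u (lab a)) \<and>
     (\<forall>j<n. 0 < u j \<longrightarrow> card (joined u i lab j) < \<kappa>) \<and>
     (\<forall>a<i. \<forall>j<n. u a \<le> 0 \<longrightarrow> u (lab a) < u j \<longrightarrow> \<kappa> \<le> Suc (card (joined u i lab j)))"

lemma finite_joined [simp]: "finite (joined u i lab j)"
  by (simp add: joined_def)

lemma card_joined_Suc:
  "card (joined u (Suc i) (lab(i := b)) j) =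
     (if u i \<le> 0 \<and> b = j then Suc (card (joined u i lab j)) else card (joined u i lab j))"
proof (cases "u i \<le> 0 \<and> b = j")
  case True
  then have "joined u (Suc i) (lab(i := b)) j = insert i (joined u i lab j)"
    by (auto simp: joined_def)
  moreover have "i \<notin> joined u i lab j" by (simp add: joined_def)
  ultimately show ?thesis using True by simp
next
  case False
  then have "joined u (Suc i) (lab(i := b)) j = joined u i lab j"
    by (auto simp: joined_def less_Suc_eq)
  with False show ?thesis by auto
qed

lemma greedy_0: "0 < \<kappa> \<Longrightarrow> greedy u n \<kappa> 0 lab"
  by (simp add: greedy_def joined_def)

text \<open>Counts never decrease, so leaders that were full for earlier agents stay full. The
  strict inequality in the second hypothesis leaves a place for \<open>i\<close>; the third
  hypothesis is the greedy choice of \<open>i\<close>.\<close>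

lemma greedy_Suc:
  assumes "greedy u n \<kappa> i lab"
    and "b = i \<or> u i \<le> 0 \<and> b < n \<and> 0 < u b \<and> Suc (card (joined u i lab b)) < \<kappa>"
    and "\<And>j. u i \<le> 0 \<Longrightarrow> j < n \<Longrightarrow> u b < u j \<Longrightarrow> \<kappa> \<le> Suc (card (joined u i lab j))"
  shows "greedy u n \<kappa> (Suc i) (lab(i := b))"
  unfolding greedy_def card_joined_Suc
proof (intro conjI allI impI)
  fix a assume "a < Suc i"
  with assms(1,2) show "(lab(i := b)) a = a \<or>
      u a \<le> 0 \<and> (lab(i := b)) a < n \<and> 0 < u ((lab(i := b)) a)"
    by (auto simp: greedy_def less_Suc_eq)
next
  fix j assume "j < n" "0 < u j"
  with assms(1,2) show "(if u i \<le> 0 \<and> b = j then Suc (card (joined u i lab j))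
      else card (joined u i lab j)) < \<kappa>"
    by (auto simp: greedy_def)
next
  fix a j assume "a < Suc i" "j < n" "u a \<le> 0" "u ((lab(i := b)) a) < u j"
  then have "\<kappa> \<le> Suc (card (joined u i lab j))"
    using assms(1,3) by (cases "a = i") (auto simp: greedy_def less_Suc_eq)
  then show "\<kappa> \<le> Suc (if u i \<le> 0 \<and> b = j then Suc (card (joined u i lab j))
      else card (joined u i lab j))"
    by auto
qed

section \<open>Coalitions as classes of equal labels\<close>

definition label_class :: "'a list \<Rightarrow> (nat \<Rightarrow> nat) \<Rightarrow> nat \<Rightarrow> 'a set" where
  "label_class xs lab l = {xs ! j | j. j < length xs \<and> lab j = l}"

lemma finite_label_class [simp]: "finite (label_class xs lab l)"
  by (simp add: label_class_def)

lemma card_label_class: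
  assumes "distinct xs"
  shows "card (label_class xs lab l) = card {j. j < length xs \<and> lab j = l}"
proof -
  have "label_class xs lab l = (!) xs ` {j. j < length xs \<and> lab j = l}"
    by (auto simp: label_class_def)
  with assms show ?thesis by (auto intro!: card_image inj_on_nth)
qed

lemma output_partition_eq:
  "output_partition xs \<sigma> = (\<lambda>i. label_class xs (nmem \<sigma> 1) (nmem \<sigma> 1 i)) ` {..<length xs}"
  by (auto simp: output_partition_def label_class_def)

lemma nth_in_label_class:
  assumes "distinct xs" "i < length xs"
  shows "xs ! i \<in> label_class xs lab l \<longleftrightarrow> lab i = l"
  using assms by (auto simp: label_class_def nth_eq_iff_index_eq)

lemma partition_on_label_classes:
  assumes "distinct xs"
  shows "partition_on (set xs) ((\<lambda>i. label_class xs lab (lab i)) ` {..<length xs})"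
proof (rule partition_onI)
  show "\<Union>((\<lambda>i. label_class xs lab (lab i)) ` {..<length xs}) = set xs"
    by (force simp: label_class_def in_set_conv_nth)
next
  fix A B
  assume "A \<in> (\<lambda>i. label_class xs lab (lab i)) ` {..<length xs}"
    "B \<in> (\<lambda>i. label_class xs lab (lab i)) ` {..<length xs}" "A \<noteq> B"
  then show "disjnt A B"
    using assms by (auto simp: label_class_def disjnt_iff nth_eq_iff_index_eq)
qed (auto simp: label_class_def)

lemma coalition_of_label_classes:
  assumes "distinct xs" "i < length xs"
  shows "coalition_of ((\<lambda>i. label_class xs lab (lab i)) ` {..<length xs}) (xs ! i) =
           label_class xs lab (lab i)"
  unfolding coalition_of_def
proof (rule the_equality)
  show "label_class xs lab (lab i) \<in> (\<lambda>i. label_class xs lab (lab i)) ` {..<length xs} \<and>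
      xs ! i \<in> label_class xs lab (lab i)"
    using assms by (auto simp: nth_in_label_class)
next
  fix C assume "C \<in> (\<lambda>i. label_class xs lab (lab i)) ` {..<length xs} \<and> xs ! i \<in> C"
  then show "C = label_class xs lab (lab i)"
    using assms by (auto simp: nth_in_label_class)
qed

text \<open>An agent of positive total hurts the coalition it abandons; an agent of total 0 gains
  nothing by moving, because the leaders better than its own are full.\<close>

lemma greedy_stable:
  assumes heg: "heg N S e \<kappa>" and xs: "distinct xs" "set xs = N"
    and u: "\<And>i. i < length xs \<Longrightarrow> u i = (\<Sum>s\<in>S. e (xs ! i) s)"
    and greedy: "greedy u (length xs) \<kappa> (length xs) lab"
  shows "contractually_individually_stable N S e \<kappa>
           ((\<lambda>i. label_class xs lab (lab i)) ` {..<length xs})"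
    (is "contractually_individually_stable _ _ _ _ ?\<pi>")
proof -
  let ?n = "length xs"
  have fin: "finite S" and e: "\<And>i s. i < ?n \<Longrightarrow> s \<in> S \<Longrightarrow> 0 \<le> e (xs ! i) s" and \<kappa>: "0 < \<kappa>"
    using heg xs by (auto simp: heg_def)
  have zero: "e (xs ! i) s = 0" if "i < ?n" "u i \<le> 0" "s \<in> S" for i s
  proof -
    have "(\<Sum>s\<in>S. e (xs ! i) s) = 0"
      using that u e by (intro antisym sum_nonneg) auto
    with fin e that show ?thesis by (simp add: sum_nonneg_eq_0_iff)
  qed
  have lab: "lab i = i \<or> u i \<le> 0 \<and> lab i < ?n \<and> 0 < u (lab i)" if "i < ?n" for i
    using greedy that by (simp add: greedy_def)
  \<comment> \<open>Unless \<open>lab i = i\<close>, the label is a leader, and its positive total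
    rules out the second alternative of \<open>lab\<close> for it. Hence labels are fixed points of
    \<open>lab\<close>.\<close>
  have lab_lab: "lab (lab i) = lab i \<and> lab i < ?n" if "i < ?n" for i
    using lab[OF that] lab[of "lab i"] that by auto
  \<comment> \<open>An agent with \<open>0 < u j\<close> carries its own label, so here it is
    \<open>lab i\<close> itself; the others have expertise 0 in every skill.\<close>
  have dominated: "e (xs ! j) s \<le> e (xs ! lab i) s"
    if "i < ?n" "j < ?n" "lab j = lab i \<or> u j \<le> 0" "s \<in> S" for i j s
    using that lab[of j] zero[of j s] e lab_lab[of i] by (cases "u j \<le> 0") auto
  \<comment> \<open>\<open>A = {}\<close> gives the utility of a coalition, \<open>A = {x}\<close>
    the utility after a newcomer of total 0 has joined.\<close>
  have utility: "utility S e (A \<union> label_class xs lab (lab i)) = u (lab i)"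
    if "i < ?n" "A \<subseteq> (!) xs ` {j. j < ?n \<and> u j \<le> 0}" for A i
  proof -
    have "utility S e (A \<union> label_class xs lab (lab i)) = (\<Sum>s\<in>S. e (xs ! lab i) s)"
    proof (rule utility_eq_leader)
      show "finite (A \<union> label_class xs lab (lab i))"
        using that(2) by (auto intro: finite_subset)
      show "xs ! lab i \<in> A \<union> label_class xs lab (lab i)"
        using lab_lab[OF that(1)] by (auto simp: label_class_def)
      show "e y s \<le> e (xs ! lab i) s"
        if "y \<in> A \<union> label_class xs lab (lab i)" "s \<in> S" for y s
        using that dominated[OF \<open>i < ?n\<close>, of _ s] \<open>A \<subseteq> _\<close> by (auto simp: label_class_def)
    qed
    with u lab_lab[OF that(1)] show ?thesis by simp
  qed
  have members: "{j. j < ?n \<and> lab j = l} = insert l (joined u ?n lab l)"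
    if "l < ?n" "0 < u l" "lab l = l" for l
    using that lab by (force simp: joined_def)
  have card_class: "card (label_class xs lab l) = Suc (card (joined u ?n lab l))"
    if "l < ?n" "0 < u l" "lab l = l" for l
    unfolding card_label_class[OF xs(1)] members[OF that] using that(2)
    by (subst card_insert_disjoint) (auto simp: joined_def)
  have solution: "solution N \<kappa> ?\<pi>"
    unfolding solution_def
  proof (intro conjI ballI)
    show "partition_on N ?\<pi>"
      using partition_on_label_classes[OF xs(1)] xs(2) by simp
    fix C assume "C \<in> ?\<pi>"
    then obtain i where i: "i < ?n" "C = label_class xs lab (lab i)" by auto
    show "card C \<le> \<kappa>"
    proof (cases "0 < u (lab i)")
      case True
      with i lab_lab[OF i(1)] greedy show ?thesis by (auto simp: card_class greedy_def Suc_le_eq)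
    next
      case False
      \<comment> \<open>A label without positive total is carried only by its own agent, so the
        class is a singleton, and \<open>0 < \<kappa>\<close> admits it.\<close>
      with lab have "lab j = j" if "j < ?n" "lab j = lab i" for j using that by metis
      with i(1) have "{j. j < ?n \<and> lab j = lab i} = {i}" by auto
      with i \<kappa> show ?thesis by (simp add: card_label_class[OF xs(1)])
    qed
  qed
  have "utility S e (coalition_of ?\<pi> x) \<ge> utility S e (C \<union> {x}) \<or>
      utility S e C > utility S e (C \<union> {x}) \<or>
      utility S e (coalition_of ?\<pi> x) > utility S e (coalition_of ?\<pi> x - {x})"
    if x: "x \<in> N" and C: "C \<in> ?\<pi>" "card C < \<kappa>" for x C
  proof -
    obtain i where i: "i < ?n" "x = xs ! i" using x xs(2) by (auto simp: in_set_conv_nth)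
    obtain k where k: "k < ?n" "C = label_class xs lab (lab k)" using C(1) by auto
    have coal: "coalition_of ?\<pi> x = label_class xs lab (lab i)"
      using i coalition_of_label_classes[OF xs(1)] by simp
    have util: "utility S e (coalition_of ?\<pi> x) = u (lab i)"
      using utility[of i "{}"] i coal by simp
    show ?thesis
    proof (cases "0 < u i")
      case True
      then have lab_i: "lab i = i" using lab[OF i(1)] by auto
      \<comment> \<open>All members other than \<open>x\<close> have expertise 0, so any of them
        dominates the rest; if there is none, the convention for \<open>{}\<close> applies.\<close>
      have "utility S e (label_class xs lab i - {x}) = 0"
      proof (cases "label_class xs lab i - {x} = {}")
        case False
        have null: "e y s = 0" if y: "y \<in> label_class xs lab i - {x}" and s: "s \<in> S" for y s
        proof -
          obtain j where j: "j < ?n" "lab j = i" "y = xs ! j" "j \<noteq> i"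
            using y i by (fastforce simp: label_class_def)
          then have "u j \<le> 0" using lab[of j] by auto
          with zero j s show ?thesis by simp
        qed
        from False obtain y where y: "y \<in> label_class xs lab i - {x}" by blast
        have "utility S e (label_class xs lab i - {x}) = (\<Sum>s\<in>S. e y s)"
          using y null by (intro utility_eq_leader) auto
        with y null show ?thesis by simp
      qed (simp add: utility_def)
      with True util coal lab_i show ?thesis by simp
    next
      case False
      then have "utility S e (C \<union> {x}) = u (lab k)"
        using utility[of k "{x}"] i k by auto
      moreover have "u (lab k) \<le> u (lab i)"
      proof (rule ccontr)
        assume less: "\<not> u (lab k) \<le> u (lab i)"
        with False i greedy lab_lab[OF k(1)]
        have full: "\<kappa> \<le> Suc (card (joined u ?n lab (lab k)))"
          by (auto simp: greedy_def)
        \<comment> \<open>With \<open>less\<close> this makes \<open>u (lab k)\<close> positive, so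
          \<open>card_class\<close> applies and \<open>full\<close> contradicts the free place in
          \<open>C\<close>.\<close>
        have "0 \<le> u (lab i)"
          using u[of "lab i"] e lab_lab[OF i(1)] by (auto intro: sum_nonneg)
        with less full C(2) k lab_lab[OF k(1)] card_class show False by auto
      qed
      ultimately show ?thesis using util by simp
    qed
  qed
  with solution show ?thesis
    unfolding contractually_individually_stable_def by blast
qed

subsection \<open>Reasoning about programs and their running time\<close>

text \<open>The postcondition also receives the step count, so that termination, result and running
  time are proved together.\<close>

definition runs :: "com \<Rightarrow> (nat \<Rightarrow> state \<Rightarrow> bool) \<Rightarrow> state \<Rightarrow> bool" where
  "runs P Q \<sigma> \<longleftrightarrow> (\<exists>t \<tau>. exec P \<sigma> t \<tau> \<and> Q t \<tau>)"

lemma runs_mono: "runs P Q \<sigma> \<Longrightarrow> (\<And>t \<tau>. Q t \<tau> \<Longrightarrow> R t \<tau>) \<Longrightarrow> runs P R \<sigma>"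
  by (auto simp: runs_def)

lemma runs_Skip: "runs Skip Q \<sigma> \<longleftrightarrow> Q 1 \<sigma>"
  unfolding runs_def by (metis SkipE exec.Skip)

lemma runs_NSet: "runs (NSet a i x) Q \<sigma> \<longleftrightarrow>
    Q (1 + ncost i + ncost x) (nupdate a (nval i \<sigma>) (nval x \<sigma>) \<sigma>)"
  unfolding runs_def by (metis NSetE exec.NSet plus_1_eq_Suc add_Suc)

lemma runs_RSet: "runs (RSet a i x) Q \<sigma> \<longleftrightarrow>
    Q (1 + ncost i + rcost x) (rupdate a (nval i \<sigma>) (rval x \<sigma>) \<sigma>)"
  unfolding runs_def by (metis RSetE exec.RSet plus_1_eq_Suc add_Suc)

lemma runs_Seq: "runs (Seq P P') Q \<sigma> \<longleftrightarrow> runs P (\<lambda>t. runs P' (\<lambda>t'. Q (t + t'))) \<sigma>"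
  unfolding runs_def by (blast intro: exec.Seq elim: SeqE)

lemma runs_Cond: "runs (Cond b P P') Q \<sigma> \<longleftrightarrow>
    (if bval b \<sigma> then runs P (\<lambda>t. Q (1 + bcost b + t)) \<sigma>
     else runs P' (\<lambda>t. Q (1 + bcost b + t)) \<sigma>)"
  unfolding runs_def by (auto intro: exec.CondTrue[simplified] exec.CondFalse[simplified] elim!: CondE)

lemmas runs_simps = runs_Skip runs_NSet runs_RSet runs_Seq runs_Cond

text \<open>The loop makes exactly \<open>n\<close> passes and the invariant is indexed by the
  passes made. Each pass costs its test plus at most \<open>T\<close>; the extra
  \<open>1 + bcost b\<close> is the final failing test.\<close>

lemma runs_Loop:
  assumes "I 0 \<sigma>"
    and "\<And>k \<sigma>. k < n \<Longrightarrow> I k \<sigma> \<Longrightarrow> bval b \<sigma> \<and> runs P (\<lambda>t \<tau>. t \<le> T \<and> I (Suc k) \<tau>) \<sigma>"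
    and stop: "\<And>\<sigma>. I n \<sigma> \<Longrightarrow> \<not> bval b \<sigma>"
  shows "runs (Loop b P) (\<lambda>t \<tau>. t \<le> 1 + bcost b + n * (1 + bcost b + T) \<and> I n \<tau>) \<sigma>"
proof -
  have "runs (Loop b P) (\<lambda>t \<tau>. t \<le> 1 + bcost b + (n - k) * (1 + bcost b + T) \<and> I n \<tau>) \<sigma>"
    if "k \<le> n" "I k \<sigma>" for k \<sigma>
    using that
  proof (induction k arbitrary: \<sigma> rule: inc_induct)
    case base
    then show ?case unfolding runs_def by (fastforce intro: exec.LoopFalse dest: stop)
  next
    case (step k)
    from assms(2)[OF step.hyps(2) step.prems] obtain t \<rho> where
      b: "bval b \<sigma>" and P: "exec P \<sigma> t \<rho>" "t \<le> T" "I (Suc k) \<rho>" by (auto simp: runs_def)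
    from step.IH[OF P(3)] obtain u \<tau> where
      loop: "exec (Loop b P) \<rho> u \<tau>" "u \<le> 1 + bcost b + (n - Suc k) * (1 + bcost b + T)" "I n \<tau>"
      by (auto simp: runs_def)
    have "n - k = Suc (n - Suc k)" using step.hyps(2) by simp
    with P(2) loop(2) have "1 + bcost b + t + u \<le> 1 + bcost b + (n - k) * (1 + bcost b + T)"
      by simp
    with exec.LoopTrue[OF b P(1) loop(1)] loop(3) show ?case unfolding runs_def by blast
  qed
  from this[of 0] assms(1) show ?thesis by simp
qed

lemma nmem_nupdate [simp]:
  "nmem (nupdate a k v \<sigma>) a' = (if a' = a then (nmem \<sigma> a)(k := v) else nmem \<sigma> a')"
  by (simp add: nupdate_def)

lemma rmem_nupdate [simp]: "rmem (nupdate a k v \<sigma>) = rmem \<sigma>"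
  by (simp add: nupdate_def)

lemma rmem_rupdate [simp]:
  "rmem (rupdate a k v \<sigma>) a' = (if a' = a then (rmem \<sigma> a)(k := v) else rmem \<sigma> a')"
  by (simp add: rupdate_def)

lemma nmem_rupdate [simp]: "nmem (rupdate a k v \<sigma>) = nmem \<sigma>"
  by (simp add: rupdate_def)

subsection \<open>The program\<close>

text \<open>
  Natural array 2 counts the agents of expertise zero that have joined each leader, and real
  array 1 contains the total expertise of each agent. Cell 0 of natural arrays 3 to 6 serves as a
  variable: the current agent, the index of an inner loop, the best leader found so far, and the
  current cell of the expertise matrix.
\<close>

abbreviation "var a \<equiv> NGet a (NConst 0)"
abbreviation "assign a x \<equiv> NSet a (NConst 0) x"
abbreviation "incr a \<equiv> assign a (NAdd (var a) (NConst 1))"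
abbreviation "num_agents \<equiv> NGet 0 (NConst 0)"
abbreviation "num_skills \<equiv> NGet 0 (NConst 1)"
abbreviation "size_bound \<equiv> NGet 0 (NConst 2)"
abbreviation "nless x y \<equiv> BNot (NLe y x)"
abbreviation "rless x y \<equiv> BNot (RLe y x)"

text \<open>Cell 0 of natural array 6 is never reset but walks through the whole matrix; this
  replaces the product \<open>i * m\<close>, which the machine cannot form on indices.\<close>

definition sum_row :: com where
  "sum_row = Loop (nless (var 4) num_skills)
     (Seq (RSet 1 (var 3) (RAdd (RGet 1 (var 3)) (RGet 0 (var 6))))
     (Seq (incr 6) (incr 4)))"

definition sum_rows :: com where
  "sum_rows = Loop (nless (var 3) num_agents)
     (Seq (assign 4 (NConst 0)) (Seq sum_row (incr 3)))"

text \<open>The search starts from the agent itself, of total 0, so a strictly larger total already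
  means being a leader, and staying alone is the default outcome. The added 1 is the leader's own
  place.\<close>

definition search_leader :: com where
  "search_leader = Loop (nless (var 4) num_agents)
     (Seq (Cond (BAnd (nless (NAdd (NGet 2 (var 4)) (NConst 1)) size_bound)
                      (rless (RGet 1 (var 5)) (RGet 1 (var 4))))
             (assign 5 (var 4)) Skip)
          (incr 4))"

definition label_agents :: com where
  "label_agents = Loop (nless (var 3) num_agents)
     (Seq (assign 5 (var 3))
     (Seq (Cond (RLe (RGet 1 (var 3)) (RConst 0))
             (Seq (assign 4 (NConst 0))
             (Seq search_leader
                  (NSet 2 (var 5) (NAdd (NGet 2 (var 5)) (NConst 1)))))
             Skip)
     (Seq (NSet 1 (var 3) (var 5)) (incr 3))))"

definition greedy_program :: com where
  "greedy_program = Seq sum_rows (Seq (assign 3 (NConst 0)) label_agents)"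

section \<open>Phase one: the total expertise of every agent\<close>

definition sizes :: "nat \<Rightarrow> nat \<Rightarrow> nat \<Rightarrow> state \<Rightarrow> bool" where
  "sizes n m \<kappa> \<sigma> \<longleftrightarrow> nmem \<sigma> 0 0 = n \<and> nmem \<sigma> 0 (Suc 0) = m \<and> nmem \<sigma> 0 2 = \<kappa>"

lemma sizes_update [simp]:
  "a \<noteq> 0 \<Longrightarrow> sizes n m \<kappa> (nupdate a k v \<sigma>) = sizes n m \<kappa> \<sigma>"
  "sizes n m \<kappa> (rupdate b k w \<sigma>) = sizes n m \<kappa> \<sigma>"
  by (simp_all add: sizes_def)

text \<open>One invariant for both nested loops. A finished row, \<open>k = m\<close>, turns into
  \<open>k = 0\<close> of the next row when cell 0 of natural array 3 is incremented. The zero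
  counters are recorded for the labelling phase.\<close>

definition summing :: "(nat \<Rightarrow> real) \<Rightarrow> nat \<Rightarrow> nat \<Rightarrow> nat \<Rightarrow> nat \<Rightarrow> nat \<Rightarrow> state \<Rightarrow> bool" where
  "summing E n m \<kappa> i k \<sigma> \<longleftrightarrow> sizes n m \<kappa> \<sigma> \<and> rmem \<sigma> 0 = E \<and> nmem \<sigma> 2 = (\<lambda>_. 0) \<and>
     nmem \<sigma> 3 0 = i \<and> nmem \<sigma> 6 0 = i * m + k \<and>
     (\<forall>j. rmem \<sigma> 1 j = (\<Sum>l<(if j < i then m else if j = i then k else 0). E (j * m + l)))"

text \<open>Here 7 is \<open>1 + bcost\<close> of the loop test, and 31 adds 24 as a bound for the
  body. The constants of the other loops arise in the same way.\<close>

lemma runs_sum_row: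
  assumes "summing E n m \<kappa> i 0 \<sigma>" "nmem \<sigma> 4 0 = 0"
  shows "runs sum_row (\<lambda>t \<tau>. t \<le> 7 + m * 31 \<and> summing E n m \<kappa> i m \<tau> \<and> nmem \<tau> 4 0 = m) \<sigma>"
proof -
  have "runs sum_row (\<lambda>t \<tau>. t \<le> 1 + bcost (nless (var 4) num_skills)
        + m * (1 + bcost (nless (var 4) num_skills) + 24)
        \<and> (summing E n m \<kappa> i m \<tau> \<and> nmem \<tau> 4 0 = m)) \<sigma>"
    unfolding sum_row_def
  proof (rule runs_Loop[where n = m and I = "\<lambda>k \<tau>. summing E n m \<kappa> i k \<tau> \<and> nmem \<tau> 4 0 = k"])
    show "summing E n m \<kappa> i 0 \<sigma> \<and> nmem \<sigma> 4 0 = 0" using assms by simp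
  next
    fix k \<sigma> assume "k < m" and inv: "summing E n m \<kappa> i k \<sigma> \<and> nmem \<sigma> 4 0 = k"
    then show "bval (nless (var 4) num_skills) \<sigma> \<and>
        runs (Seq (RSet 1 (var 3) (RAdd (RGet 1 (var 3)) (RGet 0 (var 6)))) (Seq (incr 6) (incr 4)))
          (\<lambda>t \<tau>. t \<le> 24 \<and> summing E n m \<kappa> i (Suc k) \<tau> \<and> nmem \<tau> 4 0 = Suc k) \<sigma>"
      by (auto simp: runs_simps summing_def) (auto simp: sizes_def)
  next
    fix \<sigma> assume "summing E n m \<kappa> i m \<sigma> \<and> nmem \<sigma> 4 0 = m"
    then show "\<not> bval (nless (var 4) num_skills) \<sigma>" by (simp add: summing_def sizes_def)
  qed
  then show ?thesis by (rule runs_mono) simp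
qed

lemma runs_sum_rows:
  assumes "summing E n m \<kappa> 0 0 \<sigma>"
  shows "runs sum_rows (\<lambda>t \<tau>. t \<le> 7 + n * (23 + m * 31) \<and> summing E n m \<kappa> n 0 \<tau>) \<sigma>"
proof -
  have "runs sum_rows (\<lambda>t \<tau>. t \<le> 1 + bcost (nless (var 3) num_agents)
        + n * (1 + bcost (nless (var 3) num_agents) + (16 + m * 31))
        \<and> summing E n m \<kappa> n 0 \<tau>) \<sigma>"
    unfolding sum_rows_def
  proof (rule runs_Loop[where n = n and I = "\<lambda>i. summing E n m \<kappa> i 0"])
    show "summing E n m \<kappa> 0 0 \<sigma>" by fact
  next
    fix i \<sigma> assume "i < n" and inv: "summing E n m \<kappa> i 0 \<sigma>"
    have "runs (Seq sum_row (incr 3))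
        (\<lambda>t \<tau>. t \<le> 13 + m * 31 \<and> summing E n m \<kappa> (Suc i) 0 \<tau>) (nupdate 4 0 0 \<sigma>)"
      unfolding runs_Seq
    proof (rule runs_mono, rule runs_sum_row)
      show "summing E n m \<kappa> i 0 (nupdate 4 0 0 \<sigma>)" using inv by (simp add: summing_def)
    next
      fix t \<tau> assume "t \<le> 7 + m * 31 \<and> summing E n m \<kappa> i m \<tau> \<and> nmem \<tau> 4 0 = m"
      then show "runs (incr 3) (\<lambda>t'. (\<lambda>t \<tau>. t \<le> 13 + m * 31 \<and> summing E n m \<kappa> (Suc i) 0 \<tau>) (t + t')) \<tau>"
        by (auto simp: runs_simps summing_def less_Suc_eq)
    qed simp
    then have "runs (Seq (assign 4 (NConst 0)) (Seq sum_row (incr 3)))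
          (\<lambda>t \<tau>. t \<le> 16 + m * 31 \<and> summing E n m \<kappa> (Suc i) 0 \<tau>) \<sigma>"
      unfolding runs_Seq[of "assign 4 _"] runs_NSet
      by (auto elim!: runs_mono)
    with \<open>i < n\<close> inv show "bval (nless (var 3) num_agents) \<sigma> \<and>
        runs (Seq (assign 4 (NConst 0)) (Seq sum_row (incr 3)))
          (\<lambda>t \<tau>. t \<le> 16 + m * 31 \<and> summing E n m \<kappa> (Suc i) 0 \<tau>) \<sigma>"
      by (simp add: summing_def sizes_def)
  next
    fix \<sigma> assume "summing E n m \<kappa> n 0 \<sigma>"
    then show "\<not> bval (nless (var 3) num_agents) \<sigma>" by (simp add: summing_def sizes_def)
  qed
  then show ?thesis by (rule runs_mono) (simp add: add.assoc)
qed

section \<open>Phase two: the greedy labels\<close>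

definition labelling :: "(nat \<Rightarrow> real) \<Rightarrow> nat \<Rightarrow> nat \<Rightarrow> nat \<Rightarrow> nat \<Rightarrow> (nat \<Rightarrow> nat) \<Rightarrow> state \<Rightarrow> bool" where
  "labelling u n m \<kappa> i lab \<sigma> \<longleftrightarrow> sizes n m \<kappa> \<sigma> \<and> rmem \<sigma> 1 = u \<and> nmem \<sigma> 1 = lab \<and>
     nmem \<sigma> 2 = (\<lambda>j. card (joined u i lab j)) \<and> nmem \<sigma> 3 0 = i"

definition best_leader :: "(nat \<Rightarrow> real) \<Rightarrow> nat \<Rightarrow> nat \<Rightarrow> nat \<Rightarrow> (nat \<Rightarrow> nat) \<Rightarrow> nat \<Rightarrow> nat \<Rightarrow> bool" where
  "best_leader u n \<kappa> i lab k b \<longleftrightarrow>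
     (b = i \<or> b < n \<and> u i < u b \<and> Suc (card (joined u i lab b)) < \<kappa>) \<and>
     (\<forall>j<k. u b < u j \<longrightarrow> \<kappa> \<le> Suc (card (joined u i lab j)))"

text \<open>Passing to a strictly better candidate only shrinks the set of \<open>j\<close> with
  \<open>u b < u j\<close>, and a candidate passed over is full or no better than \<open>b\<close>.
  At the end \<open>best_leader\<close> provides the hypotheses of
  \<open>greedy_Suc\<close>.\<close>

lemma runs_search_leader:
  assumes "labelling u n m \<kappa> i lab \<sigma>" "nmem \<sigma> 4 0 = 0" "nmem \<sigma> 5 0 = i"
  shows "runs search_leader (\<lambda>t \<tau>. t \<le> 7 + n * 37 \<and>
           labelling u n m \<kappa> i lab \<tau> \<and> best_leader u n \<kappa> i lab n (nmem \<tau> 5 0)) \<sigma>"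
proof -
  let ?I = "\<lambda>k \<tau>. labelling u n m \<kappa> i lab \<tau> \<and> nmem \<tau> 4 0 = k \<and> best_leader u n \<kappa> i lab k (nmem \<tau> 5 0)"
  have "runs search_leader (\<lambda>t \<tau>. t \<le> 1 + bcost (nless (var 4) num_agents)
        + n * (1 + bcost (nless (var 4) num_agents) + 30) \<and> ?I n \<tau>) \<sigma>"
    unfolding search_leader_def
  proof (rule runs_Loop[where n = n and I = ?I])
    show "?I 0 \<sigma>" using assms by (simp add: best_leader_def)
  next
    fix k \<sigma> assume "k < n" and inv: "?I k \<sigma>"
    then show "bval (nless (var 4) num_agents) \<sigma> \<and>
        runs (Seq (Cond (BAnd (nless (NAdd (NGet 2 (var 4)) (NConst 1)) size_bound)
                              (rless (RGet 1 (var 5)) (RGet 1 (var 4))))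
                     (assign 5 (var 4)) Skip)
                  (incr 4))
          (\<lambda>t \<tau>. t \<le> 30 \<and> ?I (Suc k) \<tau>) \<sigma>"
      by (auto simp: runs_simps labelling_def sizes_def best_leader_def less_Suc_eq)
  next
    fix \<sigma> assume "?I n \<sigma>"
    then show "\<not> bval (nless (var 4) num_agents) \<sigma>" by (simp add: labelling_def sizes_def)
  qed
  then show ?thesis by (rule runs_mono) simp
qed

lemma runs_label_agents:
  assumes "labelling u n m \<kappa> 0 lab \<sigma>" "0 < \<kappa>" "\<And>i. 0 \<le> u i"
  shows "runs label_agents (\<lambda>t \<tau>. t \<le> 7 + n * (60 + n * 37) \<and> greedy u n \<kappa> n (nmem \<tau> 1)) \<sigma>"
proof -
  let ?I = "\<lambda>i \<tau>. \<exists>lab. labelling u n m \<kappa> i lab \<tau> \<and> greedy u n \<kappa> i lab"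
  let ?search = "Seq search_leader (NSet 2 (var 5) (NAdd (NGet 2 (var 5)) (NConst 1)))"
  let ?step = "Seq (assign 5 (var 3))
     (Seq (Cond (RLe (RGet 1 (var 3)) (RConst 0)) (Seq (assign 4 (NConst 0)) ?search) Skip)
     (Seq (NSet 1 (var 3) (var 5)) (incr 3)))"
  have "runs label_agents (\<lambda>t \<tau>. t \<le> 1 + bcost (nless (var 3) num_agents)
        + n * (1 + bcost (nless (var 3) num_agents) + (53 + n * 37)) \<and> ?I n \<tau>) \<sigma>"
    unfolding label_agents_def
  proof (rule runs_Loop[where n = n and I = ?I])
    show "?I 0 \<sigma>" using assms greedy_0 by blast
  next
    fix i \<sigma> assume "i < n" and "?I i \<sigma>"
    then obtain lab where inv: "labelling u n m \<kappa> i lab \<sigma>" and greedy: "greedy u n \<kappa> i lab"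
      by blast
    \<comment> \<open>The common end of both branches: once the counters fit the extended labelling,
      storing the label and advancing to the next agent restores the invariant.\<close>
    have finish: "labelling u n m \<kappa> (Suc i) (lab(i := b)) (nupdate 3 0 (Suc i) (nupdate 1 i b \<tau>)) \<and>
          greedy u n \<kappa> (Suc i) (lab(i := b))"
      if "sizes n m \<kappa> \<tau>" "rmem \<tau> 1 = u" "nmem \<tau> 1 = lab" "nmem \<tau> 3 0 = i"
         "nmem \<tau> 2 = (\<lambda>j. card (joined u (Suc i) (lab(i := b)) j))"
         "if u i \<le> 0 then best_leader u n \<kappa> i lab n b else b = i" for \<tau> b
    proof
      show "greedy u n \<kappa> (Suc i) (lab(i := b))"
        \<comment> \<open>Nonnegativity of \<open>u i\<close> turns \<open>u i < u b\<close> into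
          \<open>0 < u b\<close>, as required of a leader.\<close>
        using that(6) assms(3)[of i]
        by (intro greedy_Suc[OF greedy]) (auto simp: best_leader_def split: if_splits)
    qed (use that in \<open>simp add: labelling_def\<close>)
    have "runs ?step (\<lambda>t \<tau>. t \<le> 53 + n * 37 \<and> ?I (Suc i) \<tau>) \<sigma>"
    proof (cases "u i \<le> 0")
      case True
      have "runs search_leader (\<lambda>t \<tau>. t \<le> 7 + n * 37 \<and>
           labelling u n m \<kappa> i lab \<tau> \<and> best_leader u n \<kappa> i lab n (nmem \<tau> 5 0))
           (nupdate 4 0 0 (nupdate 5 0 i \<sigma>))"
        using inv by (intro runs_search_leader) (simp_all add: labelling_def)
      then have "runs search_leader (\<lambda>t \<tau>. t \<le> 7 + n * 37 \<and>
            ?I (Suc i) (nupdate 3 0 (Suc i) (nupdate 1 i (nmem \<tau> 5 0)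
                          (nupdate 2 (nmem \<tau> 5 0) (Suc (nmem \<tau> 2 (nmem \<tau> 5 0))) \<tau>))) \<and> nmem \<tau> 3 0 = i)
           (nupdate 4 0 0 (nupdate 5 0 i \<sigma>))"
      proof (rule runs_mono, elim conjE, intro conjI exI)
        fix t \<tau>
        assume inv: "labelling u n m \<kappa> i lab \<tau>" and best: "best_leader u n \<kappa> i lab n (nmem \<tau> 5 0)"
        let ?b = "nmem \<tau> 5 0"
        let ?\<tau> = "nupdate 2 ?b (Suc (nmem \<tau> 2 ?b)) \<tau>"
        note fin = finish[of ?\<tau> ?b]
        show "labelling u n m \<kappa> (Suc i) (lab(i := ?b)) (nupdate 3 0 (Suc i) (nupdate 1 i ?b ?\<tau>))"
          "greedy u n \<kappa> (Suc i) (lab(i := ?b))"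
          using fin inv best True by (auto simp: labelling_def card_joined_Suc fun_eq_iff)
        show "nmem \<tau> 3 0 = i" using inv by (simp add: labelling_def)
      qed
      then show ?thesis
        using True inv unfolding runs_simps
        by (auto simp: labelling_def elim!: runs_mono)
    next
      case False
      have "?I (Suc i) (nupdate 3 0 (Suc i) (nupdate 1 i i (nupdate 5 0 i \<sigma>)))"
        using inv False finish[of "nupdate 5 0 i \<sigma>" i]
        by (auto simp: labelling_def card_joined_Suc)
      then show ?thesis
        using False inv by (simp add: runs_simps labelling_def)
    qed
    with \<open>i < n\<close> inv show "bval (nless (var 3) num_agents) \<sigma> \<and>
        runs ?step (\<lambda>t \<tau>. t \<le> 53 + n * 37 \<and> ?I (Suc i) \<tau>) \<sigma>"
      by (simp add: labelling_def sizes_def)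
  next
    fix \<sigma> assume "?I n \<sigma>"
    then show "\<not> bval (nless (var 3) num_agents) \<sigma>" by (auto simp: labelling_def sizes_def)
  qed
  then show ?thesis by (rule runs_mono) (auto simp: labelling_def add.assoc)
qed

section \<open>The complete program and its quadratic running time\<close>

lemma runs_greedy_program:
  assumes "heg (set xs) (set ss) e \<kappa>" "distinct ss"
  shows "runs greedy_program (\<lambda>t \<tau>. t \<le> 70 * (1 + length xs + length ss) ^ 2 \<and>
           (\<exists>u. (\<forall>i<length xs. u i = (\<Sum>s\<in>set ss. e (xs ! i) s)) \<and>
                greedy u (length xs) \<kappa> (length xs) (nmem \<tau> 1))) (heg_input xs ss e \<kappa>)"
proof -
  let ?n = "length xs" and ?m = "length ss"
  define E where "E = (\<lambda>k. if k < ?n * ?m then e (xs ! (k div ?m)) (ss ! (k mod ?m)) else 0)"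
  \<comment> \<open>The value 0 outside the range agrees with the untouched cells of real array 1
    and makes \<open>u\<close> nonnegative at every index.\<close>
  define u where "u i = (\<Sum>l<(if i < ?n then ?m else 0). E (i * ?m + l))" for i
  have E: "E (i * ?m + l) = e (xs ! i) (ss ! l)" if "i < ?n" "l < ?m" for i l
  proof -
    have "i * ?m + l < Suc i * ?m" using that(2) by simp
    also have "\<dots> \<le> ?n * ?m" using that(1) by (intro mult_right_mono) auto
    finally show ?thesis using that(2) by (cases "?m = 0") (simp_all add: E_def del: length_0_conv)
  qed
  have u: "u i = (\<Sum>s\<in>set ss. e (xs ! i) s)" if "i < ?n" for i
  proof -
    have "u i = (\<Sum>l<?m. e (xs ! i) (ss ! l))" using that E by (simp add: u_def)
    also have "\<dots> = (\<Sum>s\<in>set ss. e (xs ! i) s)"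
      by (rule sum.reindex_bij_betw) (intro bij_betw_nth assms(2) refl)
    finally show ?thesis .
  qed
  have nonneg: "0 \<le> u i" for i
  proof (cases "i < ?n")
    case True
    with assms(1) show ?thesis by (auto simp: u heg_def intro!: sum_nonneg)
  qed (simp add: u_def)
  \<comment> \<open>The three extra units pay for resetting the agent index. The total
    \<open>17 + 83 * n + 31 * n * m + 37 * n * n\<close> is bounded term by term by the expanded
    square.\<close>
  have bound: "Suc (Suc (Suc (t + t'))) \<le> 70 * Suc (?n + ?m) ^ 2"
    if "t \<le> 7 + ?n * (23 + ?m * 31)" "t' \<le> 7 + ?n * (60 + ?n * 37)" for t t'
    using that by (simp add: power2_eq_square algebra_simps)
  have "summing E ?n ?m \<kappa> 0 0 (heg_input xs ss e \<kappa>)"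
    by (simp add: summing_def sizes_def heg_input_def E_def)
  then have "runs sum_rows (\<lambda>t \<tau>. t \<le> 7 + ?n * (23 + ?m * 31) \<and> summing E ?n ?m \<kappa> ?n 0 \<tau>)
      (heg_input xs ss e \<kappa>)"
    by (rule runs_sum_rows)
  then show ?thesis
    unfolding greedy_program_def runs_Seq[of sum_rows]
  proof (rule runs_mono, elim conjE)
    fix t \<tau> assume t: "t \<le> 7 + ?n * (23 + ?m * 31)" and sums: "summing E ?n ?m \<kappa> ?n 0 \<tau>"
    have "rmem \<tau> 1 = u" using sums by (auto simp: summing_def u_def)
    \<comment> \<open>No agent is labelled yet, so natural array 1 may hold anything, and the zero
      counters fit the empty sets \<open>joined\<close>.\<close>
    with sums have "labelling u ?n ?m \<kappa> 0 (nmem \<tau> 1) (nupdate 3 0 0 \<tau>)"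
      by (simp add: summing_def labelling_def joined_def)
    then have "runs label_agents (\<lambda>t \<tau>. t \<le> 7 + ?n * (60 + ?n * 37) \<and> greedy u ?n \<kappa> ?n (nmem \<tau> 1))
        (nupdate 3 0 0 \<tau>)"
      using assms(1) nonneg by (intro runs_label_agents) (auto simp: heg_def)
    then show "runs (Seq (assign 3 (NConst 0)) label_agents)
        (\<lambda>t'. (\<lambda>t \<tau>. t \<le> 70 * (1 + ?n + ?m) ^ 2 \<and>
           (\<exists>u. (\<forall>i<?n. u i = (\<Sum>s\<in>set ss. e (xs ! i) s)) \<and>
                greedy u ?n \<kappa> ?n (nmem \<tau> 1))) (t + t')) \<tau>"
      unfolding runs_Seq runs_NSet using u t
      by (auto elim!: runs_mono intro!: bound)
  qed
qed

theorem theorem3: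
  "\<exists>P. poly_time_computes_heg
         (contractually_individually_stable ::
            'a set \<Rightarrow> 'b set \<Rightarrow> ('a \<Rightarrow> 'b \<Rightarrow> real) \<Rightarrow> nat \<Rightarrow> 'a set set \<Rightarrow> bool) P"
  unfolding poly_time_computes_heg_def
proof (rule exI[of _ greedy_program], rule exI[of _ 70], rule exI[of _ 2],
    intro allI impI, elim conjE)
  fix N :: "'a set" and S :: "'b set" and e \<kappa> xs ss
  assume heg: "heg N S e \<kappa>" and xs: "distinct xs" "set xs = N" and ss: "distinct ss" "set ss = S"
  have "runs greedy_program (\<lambda>t \<tau>. t \<le> 70 * (1 + card N + card S) ^ 2 \<and>
      contractually_individually_stable N S e \<kappa> (output_partition xs \<tau>)) (heg_input xs ss e \<kappa>)"
    unfolding output_partition_eq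
  proof (rule runs_mono)
    show "runs greedy_program (\<lambda>t \<tau>. t \<le> 70 * (1 + length xs + length ss) ^ 2 \<and>
           (\<exists>u. (\<forall>i<length xs. u i = (\<Sum>s\<in>set ss. e (xs ! i) s)) \<and>
                greedy u (length xs) \<kappa> (length xs) (nmem \<tau> 1))) (heg_input xs ss e \<kappa>)"
      using heg xs ss by (intro runs_greedy_program) auto
  qed (use heg xs ss distinct_card[OF xs(1)] distinct_card[OF ss(1)] in \<open>auto intro: greedy_stable\<close>)
  then show "\<exists>t \<tau>. exec greedy_program (heg_input xs ss e \<kappa>) t \<tau> \<and>
      t \<le> 70 * (1 + card N + card S) ^ 2 \<and>
      contractually_individually_stable N S e \<kappa> (output_partition xs \<tau>)"
    by (simp add: runs_def)
qed

end
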